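(* For any two vectors $\mathbf{x},\mathbf{y}\in V$, possibly depending on $\mathbf{\Theta}$ but independent of $\mathbf{\Theta}^*$, the inequalities $$|\langle\mathbf{x},\mathbf{y}\rangle^{\mathbf{\Theta}^*}_U-\langle\mathbf{x},\mathbf{y}\rangle^{\mathbf{\Theta}}_U|-\frac{\varepsilon^*}{1-\varepsilon^*}\|\mathbf{x}\|^{\mathbf{\Theta}^*}_U\|\mathbf{y}\|^{\mathbf{\Theta}^*}_U\le|\langle\mathbf{x},\mathbf{y}\rangle_U-\langle\mathbf{x},\mathbf{y}\rangle^{\mathbf{\Theta}}_U|\le|\langle\mathbf{x},\mathbf{y}\rangle^{\mathbf{\Theta}^*}_U-\langle\mathbf{x},\mathbf{y}\rangle^{\mathbf{\Theta}}_U|+\frac{\varepsilon^*}{1-\varepsilon^*}\|\mathbf{x}\|^{\mathbf{\Theta}^*}_U\|\mathbf{y}\|^{\mathbf{\Theta}^*}_U$$ hold with probability at least $1-4\delta^*$.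
   Context: Let $\mathbb{K}=\mathbb{R}$ or $\mathbb{C}$, $U=\mathbb{K}^n$ with inner product $\langle\cdot,\cdot\rangle_U=\langle\mathbf{R}_U\cdot,\cdot\rangle$ ($\mathbf{R}_U$ symmetric/Hermitian positive definite, $\langle\cdot,\cdot\rangle$ the canonical $\ell_2$-inner product) and norm $\|\cdot\|_U$. For a matrix $\mathbf{\Theta}$ with $n$ columns, $\langle\mathbf{x},\mathbf{y}\rangle^{\mathbf{\Theta}}_U=\langle\mathbf{\Theta}\mathbf{x},\mathbf{\Theta}\mathbf{y}\rangle$ and $\|\mathbf{x}\|^{\mathbf{\Theta}}_U$ is the associated semi-norm. $V\subset U$ is a subspace, $\mathbf{\Theta}\in\mathbb{K}^{k\times n}$ is a (possibly random) matrix, $0<\varepsilon^*<1$, $0<\delta^*<1$, and $\mathbf{\Theta}^*\in\mathbb{K}^{k^*\times n}$ is a random matrix, generated independently of $\mathbf{\Theta}$ and $V$, such that for any given vectors $\mathbf{x},\mathbf{y}\in V$ the inequality $$|\langle\mathbf{x},\mathbf{y}\rangle_U-\langle\mathbf{x},\mathbf{y}\rangle^{\mathbf{\Theta}^*}_U|\le\varepsilon^*\|\mathbf{x}\|_U\|\mathbf{y}\|_U$$ holds with probability at least $1-\delta^*$. *)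

theory Defs
  imports "HOL-Probability.Probability"
begin

text \<open>
  The class of scalar fields covers exactly the real and the complex numbers: both are
  instances, and \<open>rc_scalar_cases\<close> shows that there are no others up to isomorphism.
\<close>

class rc_scalar = real_normed_field + euclidean_space +
  fixes conjg :: "'a \<Rightarrow> 'a"
  assumes conjg_add: "conjg (x + y) = conjg x + conjg y"
    and conjg_mult: "conjg (x * y) = conjg x * conjg y"
    and conjg_conjg: "conjg (conjg x) = x"
    and mult_conjg_scaleR: "x * conjg x = (norm x)\<^sup>2 *\<^sub>R 1"

instantiation real :: rc_scalar
begin
definition conjg_real :: "real \<Rightarrow> real" where "conjg_real x = x"
instance
  by standard (auto simp: conjg_real_def power2_eq_square)
end

instantiation complex :: rc_scalar
begin
definition conjg_complex :: "complex \<Rightarrow> complex" where "conjg_complex = cnj"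
instance
  by standard (auto simp: conjg_complex_def complex_norm_square[symmetric] scaleR_conv_of_real)
end

lemma mult_conjg: "x * conjg x = of_real ((norm x)\<^sup>2)" for x :: "'a::rc_scalar"
  by (simp only: mult_conjg_scaleR of_real_def)

lemma conjg_of_real: "conjg (of_real r :: 'a::rc_scalar) = of_real r"
proof (cases "r = 0")
  case True
  have "conjg (0::'a) + conjg 0 = conjg 0"
    using conjg_add[of "0::'a" 0] by simp
  then show ?thesis using True by simp
next
  case False
  have "(of_real r :: 'a) * conjg (of_real r) = of_real r * of_real r"
    by (simp add: mult_conjg power2_eq_square)
  then show ?thesis using False by simp
qed

lemma conjg_fixed_real:
  fixes z :: "'a::rc_scalar"
  assumes "conjg z = z"
  shows "z \<in> \<real>"
proof -
  have "z * z = of_real (norm z) * of_real (norm z)"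
    using mult_conjg[of z] assms by (simp add: power2_eq_square)
  then have "z = of_real (norm z) \<or> z = - of_real (norm z)"
    by (simp only: square_eq_iff)
  then show ?thesis by (metis Reals_minus Reals_of_real)
qed

lemma rc_scalar_cases:
  "(UNIV :: 'a::rc_scalar set) = \<real>
    \<or> (\<exists>i::'a. i * i = -1 \<and> conjg i = - i \<and> (\<forall>z. \<exists>a b. z = of_real a + of_real b * i))"
proof (cases "(UNIV :: 'a set) = \<real>")
  case False
  then obtain w :: 'a where w: "w \<notin> \<real>" by auto
  have minus: "conjg (- z) = - conjg z" for z :: 'a
    using conjg_mult[of "of_real (-1)" z] conjg_of_real[of "-1", where 'a = 'a] by simp
  have diff: "conjg (y - z) = conjg y - conjg z" for y z :: 'a
    using conjg_add[of y "- z"] by (simp add: minus)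
  define d where "d = w - conjg w"
  have d0: "d \<noteq> 0" using w conjg_fixed_real[of w] by (auto simp: d_def)
  have dc: "conjg d = - d" by (simp add: d_def diff conjg_conjg)
  define i where "i = of_real (1 / norm d) * d"
  have ic: "conjg i = - i" by (simp add: i_def conjg_mult conjg_of_real dc del: of_real_divide)
  have ni: "norm i = 1" using d0 by (simp add: i_def norm_mult norm_divide)
  have "i * conjg i = 1" using mult_conjg[of i] ni by simp
  then have ii: "i * i = -1" by (simp add: ic minus_equation_iff)
  have "\<exists>a b. z = of_real a + of_real b * i" for z
  proof -
    define p where "p = of_real (1/2) * (z + conjg z)"
    define q where "q = of_real (-1/2) * ((z - conjg z) * i)"
    have "conjg p = p"
      unfolding p_def by (simp only: conjg_mult conjg_of_real conjg_add conjg_conjg add.commute)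
    moreover have "conjg q = q"
      unfolding q_def by (simp only: conjg_mult conjg_of_real diff conjg_conjg ic) (simp add: algebra_simps)
    ultimately obtain a b where ab: "p = of_real a" "q = of_real b"
      using conjg_fixed_real by (metis Reals_cases)
    have "q * i = of_real (-1/2) * (z - conjg z) * (i * i)"
      by (simp add: q_def mult.assoc)
    then have "q * i = of_real (1/2) * (z - conjg z)" by (simp add: ii)
    then have "p + q * i = z" by (simp add: p_def field_simps)
    then show ?thesis using ab by metis
  qed
  then show ?thesis using ii ic by blast
qed simp

definition l2_inner :: "'a::rc_scalar ^ 'n \<Rightarrow> 'a ^ 'n \<Rightarrow> 'a" where
  "l2_inner x y = (\<Sum>i\<in>UNIV. x $ i * conjg (y $ i))"

definition hermitian_pos_def :: "'a::rc_scalar ^ 'n ^ 'n \<Rightarrow> bool" where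
  "hermitian_pos_def R \<longleftrightarrow>
     (\<forall>i j. R $ i $ j = conjg (R $ j $ i)) \<and>
     (\<forall>x. x \<noteq> 0 \<longrightarrow> (\<exists>r>0. l2_inner (R *v x) x = of_real r))"

definition inner_U :: "'a::rc_scalar ^ 'n ^ 'n \<Rightarrow> 'a ^ 'n \<Rightarrow> 'a ^ 'n \<Rightarrow> 'a" where
  "inner_U R x y = l2_inner (R *v x) y"

definition sketched_inner :: "'a::rc_scalar ^ 'n ^ 'k \<Rightarrow> 'a ^ 'n \<Rightarrow> 'a ^ 'n \<Rightarrow> 'a" where
  "sketched_inner \<Theta> x y = l2_inner (\<Theta> *v x) (\<Theta> *v y)"

text \<open>
  In the two definitions below the form evaluated at \<open>(x, x)\<close> is a nonnegative real number,
  represented as a scalar; the inner \<open>norm\<close> is the absolute value of scalars and only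
  converts it to type \<open>real\<close>.
\<close>

definition norm_U :: "'a::rc_scalar ^ 'n ^ 'n \<Rightarrow> 'a ^ 'n \<Rightarrow> real" where
  "norm_U R x = sqrt (norm (inner_U R x x))"

definition sketched_norm :: "'a::rc_scalar ^ 'n ^ 'k \<Rightarrow> 'a ^ 'n \<Rightarrow> real" where
  "sketched_norm \<Theta> x = sqrt (norm (sketched_inner \<Theta> x x))"

text \<open>
  Independence of two random variables with possibly different value types; the library
  constant \<open>indep_var\<close> forces both variables to have the same value type.
\<close>

definition indep_rv ::
  "'w measure \<Rightarrow> 'b measure \<Rightarrow> ('w \<Rightarrow> 'b) \<Rightarrow> 'c measure \<Rightarrow> ('w \<Rightarrow> 'c) \<Rightarrow> bool" where
  "indep_rv M S X T Y \<longleftrightarrow>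
     X \<in> measurable M S \<and> Y \<in> measurable M T \<and>
     prob_space.indep_set M
       {X -` A \<inter> space M |A. A \<in> sets S} {Y -` B \<inter> space M |B. B \<in> sets T}"

text \<open>
  The measurable space of sets (Effros sigma-algebra, generated by the families of all sets
  hitting a given open set), used for subspaces that may be random. A constant subspace is
  the special case of a constant function, which is measurable and independent of everything.
\<close>

definition set_space :: "'b::topological_space set measure" where
  "set_space = sigma UNIV {{S. S \<inter> G \<noteq> {}} |G. open G}"

text \<open>
  The matrix \<open>\<Theta>s\<close> is independent of the subspace, so a probability statement about \<open>\<Theta>s\<close>
  for given vectors of a random subspace is one about fixed vectors of its realized value
  \<open>V \<omega>\<close>, the probability being taken over \<open>\<omega>'\<close> only.
\<close>

definition sketches_given_vectors ::
  "'w measure \<Rightarrow> 'a::rc_scalar ^ 'n ^ 'n \<Rightarrow> ('w \<Rightarrow> ('a ^ 'n) set) \<Rightarrow>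
   ('w \<Rightarrow> 'a ^ 'n ^ 'k) \<Rightarrow> real \<Rightarrow> real \<Rightarrow> bool" where
  "sketches_given_vectors M R V \<Theta>s \<epsilon> \<delta> \<longleftrightarrow>
     (AE \<omega> in M. \<forall>u\<in>V \<omega>. \<forall>v\<in>V \<omega>.
        \<P>(\<omega>' in M. norm (inner_U R u v - sketched_inner (\<Theta>s \<omega>') u v)
                       \<le> \<epsilon> * norm_U R u * norm_U R v) \<ge> 1 - \<delta>)"

end

theory Submission
  imports Defs
begin

text \<open>
  Conditionally on \<open>(x, y)\<close> the matrix \<open>\<Theta>s\<close> keeps its law, so by independence the sketching
  inequality holds at each of the random pairs \<open>(x, y)\<close>, \<open>(x, x)\<close> and \<open>(y, y)\<close> with probability
  at least \<open>1 - \<delta>\<close>, and at all three with probability at least \<open>1 - 3\<delta>\<close>. The pairs \<open>(x, x)\<close>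
  and \<open>(y, y)\<close> bound \<open>(1 - \<epsilon>) norm_U\<^sup>2\<close> by the square of the sketched norm, which turns the
  error \<open>\<epsilon> norm_U x norm_U y\<close> at \<open>(x, y)\<close> into the computable one; the triangle inequality
  does the rest.
\<close>

text \<open>Taking norms in \<open>mult_conjg\<close> gives
  \<open>norm x * norm (conjg x) = (norm x)\<^sup>2\<close>, and a nonzero \<open>norm x\<close>
  cancels.\<close>

lemma norm_conjg: "norm (conjg x) = norm x" for x :: "'a::rc_scalar"
proof (cases "x = 0")
  case True
  then show ?thesis
    using conjg_of_real[of 0, where 'a = 'a] by simp
next
  case False
  have "norm x * norm (conjg x) = norm x * norm x"
    by (simp only: norm_mult[symmetric] mult_conjg norm_of_real) (simp add: power2_eq_square norm_mult)
  then show ?thesis using False by simp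
qed

text \<open>Real-linear because \<open>conjg\<close> is multiplicative and fixes the real scalars.
  Hence it is continuous, which is what makes the forms built on \<open>l2_inner\<close> Borel
  measurable in matrix and vectors.\<close>

lemma bounded_linear_conjg: "bounded_linear (conjg :: 'a::rc_scalar \<Rightarrow> 'a)"
  by (rule bounded_linear_intro[where K = 1])
    (simp_all add: conjg_add conjg_mult conjg_of_real scaleR_conv_of_real norm_conjg)

lemma borel_measurable_conjg [measurable]: "conjg \<in> borel_measurable borel"
  by (intro borel_measurable_continuous_onI linear_continuous_on bounded_linear_conjg)

lemma borel_measurable_vec_nth [measurable (raw)]:
  fixes f :: "'w \<Rightarrow> 'b::real_normed_vector ^ 'n"
  assumes "f \<in> borel_measurable M"
  shows "(\<lambda>\<omega>. f \<omega> $ i) \<in> borel_measurable M"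
  using assms
  by (rule measurable_compose)
    (intro borel_measurable_continuous_onI linear_continuous_on bounded_linear_vec_nth)

lemma borel_measurable_inner_U [measurable (raw)]:
  assumes [measurable]: "f \<in> borel_measurable M" "g \<in> borel_measurable M"
  shows "(\<lambda>\<omega>. inner_U R (f \<omega>) (g \<omega>)) \<in> borel_measurable M"
  unfolding inner_U_def l2_inner_def matrix_vector_mult_def by simp

lemma borel_measurable_sketched_inner [measurable (raw)]:
  assumes [measurable]: "A \<in> borel_measurable M" "f \<in> borel_measurable M" "g \<in> borel_measurable M"
  shows "(\<lambda>\<omega>. sketched_inner (A \<omega>) (f \<omega>) (g \<omega>)) \<in> borel_measurable M"
  unfolding sketched_inner_def l2_inner_def matrix_vector_mult_def by simp

lemma borel_measurable_norm_U [measurable (raw)]: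
  assumes [measurable]: "f \<in> borel_measurable M"
  shows "(\<lambda>\<omega>. norm_U R (f \<omega>)) \<in> borel_measurable M"
  unfolding norm_U_def by simp

lemma borel_measurable_sketched_norm [measurable (raw)]:
  assumes [measurable]: "A \<in> borel_measurable M" "f \<in> borel_measurable M"
  shows "(\<lambda>\<omega>. sketched_norm (A \<omega>) (f \<omega>)) \<in> borel_measurable M"
  unfolding sketched_norm_def by simp

text \<open>Independence is the product formula on measurable rectangles, and these determine a
  product of sigma-finite measures.\<close>

lemma (in prob_space) indep_rv_distr_pair:
  assumes "indep_rv M S X T Y"
  shows "distr M (S \<Otimes>\<^sub>M T) (\<lambda>\<omega>. (X \<omega>, Y \<omega>)) = distr M S X \<Otimes>\<^sub>M distr M T Y"
proof (rule pair_measure_eqI[symmetric])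
  have [measurable]: "X \<in> measurable M S" "Y \<in> measurable M T"
    and ind: "indep_set {X -` A \<inter> space M |A. A \<in> sets S} {Y -` B \<inter> space M |B. B \<in> sets T}"
    using assms by (auto simp: indep_rv_def)
  show "sigma_finite_measure (distr M S X)" "sigma_finite_measure (distr M T Y)"
    by (auto intro!: prob_space_imp_sigma_finite prob_space_distr)
  fix A B assume "A \<in> sets (distr M S X)" "B \<in> sets (distr M T Y)"
  then have [measurable]: "A \<in> sets S" "B \<in> sets T" by simp_all
  have "prob ((X -` A \<inter> space M) \<inter> (Y -` B \<inter> space M))
      = prob (X -` A \<inter> space M) * prob (Y -` B \<inter> space M)"
    by (rule indep_setD[OF ind]) auto
  moreover have "(\<lambda>\<omega>. (X \<omega>, Y \<omega>)) -` (A \<times> B) \<inter> space M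
      = (X -` A \<inter> space M) \<inter> (Y -` B \<inter> space M)"
    by auto
  ultimately show "emeasure (distr M S X) A * emeasure (distr M T Y) B
      = emeasure (distr M (S \<Otimes>\<^sub>M T) (\<lambda>\<omega>. (X \<omega>, Y \<omega>))) (A \<times> B)"
    by (simp add: emeasure_distr emeasure_eq_measure ennreal_mult)
qed simp

text \<open>Tonelli for the product law of \<open>(X, Y)\<close>: the probability on the right is
  the mean, over the law of \<open>X\<close>, of the probabilities with \<open>X\<close> frozen, and
  almost all of these are at least \<open>c\<close>. This carries a bound for fixed vectors over to
  random ones.\<close>

lemma (in prob_space) prob_ge_of_indep_rv:
  assumes ind: "indep_rv M S X T Y"
    and P [measurable]: "Measurable.pred (S \<Otimes>\<^sub>M T) (\<lambda>(u, v). P u v)"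
    and ge: "AE \<omega> in M. c \<le> \<P>(\<omega>' in M. P (X \<omega>) (Y \<omega>'))"
  shows "c \<le> \<P>(\<omega> in M. P (X \<omega>) (Y \<omega>))"
proof -
  have [measurable]: "X \<in> measurable M S" "Y \<in> measurable M T"
    using ind by (auto simp: indep_rv_def)
  interpret Y: prob_space "distr M T Y" by (rule prob_space_distr) simp
  define E where "E = {z \<in> space (S \<Otimes>\<^sub>M T). case z of (u, v) \<Rightarrow> P u v}"
  have E: "E \<in> sets (S \<Otimes>\<^sub>M T)" unfolding E_def by measurable
  \<comment> \<open>The slice of \<open>E\<close> at the realized value \<open>X \<omega>\<close> is
    measured by the law of \<open>Y\<close> alone, which is the inner probability over
    \<open>\<omega>'\<close> in the hypothesis \<open>ge\<close>.\<close>
  have slice: "emeasure (distr M T Y) (Pair (X \<omega>) -` E) = \<P>(\<omega>' in M. P (X \<omega>) (Y \<omega>'))"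
    if "\<omega> \<in> space M" for \<omega>
  proof -
    have "X \<omega> \<in> space S" using that by (simp add: measurable_space[of X M S])
    then have "Y -` (Pair (X \<omega>) -` E) \<inter> space M = {\<omega>' \<in> space M. P (X \<omega>) (Y \<omega>')}"
      by (auto simp: E_def space_pair_measure measurable_space[of Y M T])
    then show ?thesis
      using sets_Pair1[OF E] by (simp add: emeasure_distr emeasure_eq_measure)
  qed
  \<comment> \<open>The total mass is 1. A negative \<open>c\<close> is truncated to 0 by
    \<open>ennreal\<close>, which is harmless because the probability it is finally compared with is
    nonnegative.\<close>
  have "ennreal c = (\<integral>\<^sup>+\<omega>. ennreal c \<partial>M)" by (simp add: emeasure_space_1)
  also have "\<dots> \<le> (\<integral>\<^sup>+\<omega>. emeasure (distr M T Y) (Pair (X \<omega>) -` E) \<partial>M)"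
    using ge by (intro nn_integral_mono_AE) (auto simp: slice intro: ennreal_leI)
  also have "\<dots> = (\<integral>\<^sup>+u. emeasure (distr M T Y) (Pair u -` E) \<partial>distr M S X)"
    using E by (subst nn_integral_distr) (auto intro!: Y.measurable_emeasure_Pair)
  also have "\<dots> = emeasure (distr M S X \<Otimes>\<^sub>M distr M T Y) E"
    using E by (subst Y.emeasure_pair_measure_alt) auto
  also have "\<dots> = emeasure (distr M (S \<Otimes>\<^sub>M T) (\<lambda>\<omega>. (X \<omega>, Y \<omega>))) E"
    by (simp add: indep_rv_distr_pair[OF ind])
  also have "\<dots> = prob ((\<lambda>\<omega>. (X \<omega>, Y \<omega>)) -` E \<inter> space M)"
    using E by (simp add: emeasure_distr emeasure_eq_measure)
  also have "(\<lambda>\<omega>. (X \<omega>, Y \<omega>)) -` E \<inter> space M = {\<omega> \<in> space M. P (X \<omega>) (Y \<omega>)}"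
    by (auto simp: E_def space_pair_measure measurable_space[of X M S] measurable_space[of Y M T])
  finally show ?thesis by (simp add: ennreal_le_iff)
qed

text \<open>Union bound: each of the three complements has probability at most
  \<open>\<delta>\<close>.\<close>

lemma (in prob_space) prob_conj3_ge:
  assumes [measurable]: "Measurable.pred M P" "Measurable.pred M Q" "Measurable.pred M S"
    and "1 - \<delta> \<le> \<P>(\<omega> in M. P \<omega>)" "1 - \<delta> \<le> \<P>(\<omega> in M. Q \<omega>)" "1 - \<delta> \<le> \<P>(\<omega> in M. S \<omega>)"
  shows "1 - 3 * \<delta> \<le> \<P>(\<omega> in M. P \<omega> \<and> Q \<omega> \<and> S \<omega>)"
proof -
  have "prob {\<omega> \<in> space M. \<not> (P \<omega> \<and> Q \<omega> \<and> S \<omega>)}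
      \<le> prob ({\<omega> \<in> space M. \<not> P \<omega>} \<union> ({\<omega> \<in> space M. \<not> Q \<omega>} \<union> {\<omega> \<in> space M. \<not> S \<omega>}))"
    by (rule finite_measure_mono) auto
  also have "\<dots> \<le> prob {\<omega> \<in> space M. \<not> P \<omega>}
      + (prob {\<omega> \<in> space M. \<not> Q \<omega>} + prob {\<omega> \<in> space M. \<not> S \<omega>})"
    by (intro order_trans[OF measure_Un_le] add_left_mono measure_Un_le) auto
  finally show ?thesis
    using assms(4-6) prob_neg[of "\<lambda>\<omega>. P \<omega> \<and> Q \<omega> \<and> S \<omega>"]
      prob_neg[of P] prob_neg[of Q] prob_neg[of S] by (simp del: de_Morgan_conj)
qed

text \<open>Since \<open>norm_U R u * norm_U R u\<close> is \<open>norm (inner_U R u u)\<close>, the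
  reverse triangle inequality bounds \<open>(1 - \<epsilon>) * norm (inner_U R u u)\<close> by the
  squared sketched norm; then take roots.\<close>

lemma norm_U_le_sketched_norm:
  assumes "norm (inner_U R u u - sketched_inner A u u) \<le> \<epsilon> * norm_U R u * norm_U R u"
  shows "sqrt (1 - \<epsilon>) * norm_U R u \<le> sketched_norm A u"
proof -
  have "norm (inner_U R u u) - norm (sketched_inner A u u) \<le> \<epsilon> * norm (inner_U R u u)"
    using assms norm_triangle_ineq2[of "inner_U R u u" "sketched_inner A u u"]
    by (simp add: norm_U_def mult.assoc)
  then have "(1 - \<epsilon>) * norm (inner_U R u u) \<le> norm (sketched_inner A u u)"
    by (simp add: algebra_simps)
  then show ?thesis
    unfolding norm_U_def sketched_norm_def real_sqrt_mult[symmetric] by simp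
qed

text \<open>The lower bounds on the sketched norms of \<open>u\<close> and \<open>v\<close> each
  carry a factor \<open>sqrt (1 - \<epsilon>)\<close>. Their product yields
  \<open>1 - \<epsilon>\<close>, the denominator of the error constant.\<close>

lemma sketch_error_le:
  assumes "0 < \<epsilon>" "\<epsilon> < 1"
    and uv: "norm (inner_U R u v - sketched_inner A u v) \<le> \<epsilon> * norm_U R u * norm_U R v"
    and uu: "norm (inner_U R u u - sketched_inner A u u) \<le> \<epsilon> * norm_U R u * norm_U R u"
    and vv: "norm (inner_U R v v - sketched_inner A v v) \<le> \<epsilon> * norm_U R v * norm_U R v"
  shows "norm (inner_U R u v - sketched_inner A u v)
    \<le> \<epsilon> / (1 - \<epsilon>) * sketched_norm A u * sketched_norm A v"
proof -
  have "(sqrt (1 - \<epsilon>) * norm_U R u) * (sqrt (1 - \<epsilon>) * norm_U R v)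
      \<le> sketched_norm A u * sketched_norm A v"
    using assms(1,2) norm_U_le_sketched_norm[OF uu] norm_U_le_sketched_norm[OF vv]
    by (intro mult_mono) (auto simp: norm_U_def sketched_norm_def)
  moreover have "sqrt (1 - \<epsilon>) * sqrt (1 - \<epsilon>) = 1 - \<epsilon>" using assms(2) by simp
  ultimately have "(1 - \<epsilon>) * (norm_U R u * norm_U R v) \<le> sketched_norm A u * sketched_norm A v"
    by (metis mult.assoc mult.left_commute)
  then have "norm_U R u * norm_U R v \<le> sketched_norm A u * sketched_norm A v / (1 - \<epsilon>)"
    using assms(2) by (simp add: field_simps)
  then have "\<epsilon> * (norm_U R u * norm_U R v)
      \<le> \<epsilon> * (sketched_norm A u * sketched_norm A v / (1 - \<epsilon>))"
    using assms(1) by (intro mult_left_mono) auto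
  with uv show ?thesis by (simp add: mult.assoc)
qed


theorem proposition5p2:
  fixes M :: "'w measure"
    and R :: "'a::rc_scalar ^ 'n ^ 'n"
    and V :: "'w \<Rightarrow> ('a ^ 'n) set"
    and \<Theta> :: "'w \<Rightarrow> 'a ^ 'n ^ 'k"
    and \<Theta>s :: "'w \<Rightarrow> 'a ^ 'n ^ 'ks"
    and x y :: "'w \<Rightarrow> 'a ^ 'n"
    and \<epsilon> \<delta> :: real
  assumes "prob_space M"
    and "hermitian_pos_def R"
    and "0 < \<epsilon>" "\<epsilon> < 1" "0 < \<delta>" "\<delta> < 1"
    and "\<forall>\<omega>\<in>space M. vec.subspace (V \<omega>)"
    and "indep_rv M (borel \<Otimes>\<^sub>M set_space) (\<lambda>\<omega>. (\<Theta> \<omega>, V \<omega>)) borel \<Theta>s"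
    and "sketches_given_vectors M R V \<Theta>s \<epsilon> \<delta>"
    and "AE \<omega> in M. x \<omega> \<in> V \<omega> \<and> y \<omega> \<in> V \<omega>"
    and "indep_rv M borel (\<lambda>\<omega>. (x \<omega>, y \<omega>)) borel \<Theta>s"
  shows "\<P>(\<omega> in M.
      norm (sketched_inner (\<Theta>s \<omega>) (x \<omega>) (y \<omega>) - sketched_inner (\<Theta> \<omega>) (x \<omega>) (y \<omega>))
        - \<epsilon> / (1 - \<epsilon>) * sketched_norm (\<Theta>s \<omega>) (x \<omega>) * sketched_norm (\<Theta>s \<omega>) (y \<omega>)
      \<le> norm (inner_U R (x \<omega>) (y \<omega>) - sketched_inner (\<Theta> \<omega>) (x \<omega>) (y \<omega>)) \<and>
      norm (inner_U R (x \<omega>) (y \<omega>) - sketched_inner (\<Theta> \<omega>) (x \<omega>) (y \<omega>))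
      \<le> norm (sketched_inner (\<Theta>s \<omega>) (x \<omega>) (y \<omega>) - sketched_inner (\<Theta> \<omega>) (x \<omega>) (y \<omega>))
        + \<epsilon> / (1 - \<epsilon>) * sketched_norm (\<Theta>s \<omega>) (x \<omega>) * sketched_norm (\<Theta>s \<omega>) (y \<omega>))
    \<ge> 1 - 4 * \<delta>"
    (is "\<P>(\<omega> in M. ?Goal \<omega>) \<ge> _")
proof -
  interpret prob_space M by fact
  let ?G = "\<lambda>A u v. norm (inner_U R u v - sketched_inner A u v) \<le> \<epsilon> * norm_U R u * norm_U R v"
  \<comment> \<open>\<open>indep_rv\<close> contains the measurability of both its variables. That
    of \<open>x\<close>, \<open>y\<close> and \<open>\<Theta>\<close> follows by projecting, the
    Borel sets of the pair type being the product sigma-algebra.\<close>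
  have xy: "(\<lambda>\<omega>. (x \<omega>, y \<omega>)) \<in> borel_measurable M" and [measurable]: "\<Theta>s \<in> borel_measurable M"
    and \<Theta>V: "(\<lambda>\<omega>. (\<Theta> \<omega>, V \<omega>)) \<in> measurable M (borel \<Otimes>\<^sub>M set_space)"
    using assms(8,11) by (auto simp: indep_rv_def)
  have [measurable]: "x \<in> borel_measurable M" "y \<in> borel_measurable M"
    using xy by (auto simp: borel_prod[symmetric] dest: measurable_compose[OF _ measurable_fst] measurable_compose[OF _ measurable_snd])
  have [measurable]: "\<Theta> \<in> borel_measurable M"
    using measurable_compose[OF \<Theta>V measurable_fst] by simp
  \<comment> \<open>The projections \<open>p\<close> and \<open>q\<close> treat the pairs
    \<open>(x, y)\<close>, \<open>(x, x)\<close> and \<open>(y, y)\<close> at once, each as a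
    function of \<open>(x, y)\<close>, the variable known to be independent of
    \<open>\<Theta>s\<close>.\<close>
  have good: "1 - \<delta> \<le> \<P>(\<omega> in M. ?G (\<Theta>s \<omega>) (p (x \<omega>, y \<omega>)) (q (x \<omega>, y \<omega>)))"
    if pq: "p \<in> {fst, snd}" "q \<in> {fst, snd}"
    for p q :: "('a ^ 'n) \<times> ('a ^ 'n) \<Rightarrow> 'a ^ 'n"
  proof (rule prob_ge_of_indep_rv[OF assms(11), where P = "\<lambda>z A. ?G A (p z) (q z)"])
    have [measurable]: "p \<in> borel_measurable borel" "q \<in> borel_measurable borel"
      using pq by (auto intro!: borel_measurable_continuous_onI continuous_intros)
    show "Measurable.pred (borel \<Otimes>\<^sub>M borel) (\<lambda>(z, A :: 'a ^ 'n ^ 'ks). ?G A (p z) (q z))"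
      by measurable
    \<comment> \<open>For almost every \<open>\<omega>\<close> both vectors lie in
      \<open>V \<omega>\<close>, where the sketching hypothesis applies to them as fixed
      vectors.\<close>
    show "AE \<omega> in M. 1 - \<delta> \<le> \<P>(\<omega>' in M. ?G (\<Theta>s \<omega>') (p (x \<omega>, y \<omega>)) (q (x \<omega>, y \<omega>)))"
      using assms(9)[unfolded sketches_given_vectors_def] assms(10)
      by eventually_elim (use pq in auto)
  qed
  \<comment> \<open>Three events are enough, so the union bound gives
    \<open>1 - 3 * \<delta>\<close>, which exceeds the claimed bound.\<close>
  have "1 - 4 * \<delta> \<le> 1 - 3 * \<delta>" using assms(5) by simp
  also have "\<dots> \<le> \<P>(\<omega> in M. ?G (\<Theta>s \<omega>) (x \<omega>) (y \<omega>) \<and> ?G (\<Theta>s \<omega>) (x \<omega>) (x \<omega>)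
      \<and> ?G (\<Theta>s \<omega>) (y \<omega>) (y \<omega>))"
    using good[of fst snd] good[of fst fst] good[of snd snd]
    by (intro prob_conj3_ge) simp_all
  also have "\<dots> \<le> \<P>(\<omega> in M. ?Goal \<omega>)"
  proof (rule finite_measure_mono)
    show "{\<omega> \<in> space M. ?Goal \<omega>} \<in> sets M" by measurable
    \<comment> \<open>The exact error minus the sketched error is
      \<open>inner_U - sketched_inner (\<Theta>s \<omega>)\<close> at \<open>(x, y)\<close>, as the
      \<open>\<Theta>\<close> terms cancel. The reverse triangle inequality in both directions then
      gives the two sides.\<close>
    have "?Goal \<omega>"
      if "?G (\<Theta>s \<omega>) (x \<omega>) (y \<omega>)" "?G (\<Theta>s \<omega>) (x \<omega>) (x \<omega>)" "?G (\<Theta>s \<omega>) (y \<omega>) (y \<omega>)" for \<omega>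
      using sketch_error_le[OF assms(3,4) that]
        norm_triangle_ineq2[of "inner_U R (x \<omega>) (y \<omega>) - sketched_inner (\<Theta> \<omega>) (x \<omega>) (y \<omega>)"
          "sketched_inner (\<Theta>s \<omega>) (x \<omega>) (y \<omega>) - sketched_inner (\<Theta> \<omega>) (x \<omega>) (y \<omega>)"]
        norm_triangle_ineq2[of "sketched_inner (\<Theta>s \<omega>) (x \<omega>) (y \<omega>) - sketched_inner (\<Theta> \<omega>) (x \<omega>) (y \<omega>)"
          "inner_U R (x \<omega>) (y \<omega>) - sketched_inner (\<Theta> \<omega>) (x \<omega>) (y \<omega>)"]
      by (simp add: norm_minus_commute)
    then show "{\<omega> \<in> space M. ?G (\<Theta>s \<omega>) (x \<omega>) (y \<omega>) \<and> ?G (\<Theta>s \<omega>) (x \<omega>) (x \<omega>)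
      \<and> ?G (\<Theta>s \<omega>) (y \<omega>) (y \<omega>)} \<subseteq> {\<omega> \<in> space M. ?Goal \<omega>}"
      by blast
  qed
  finally show ?thesis .
qed

end
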